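(* Let $Q$ be the quiver of type $X_6$ with vertices $v_0,\dots,v_5$ and arrows $v_1\Rightarrow v_2$, $v_3\Rightarrow v_4$ (double arrows), $v_0\to v_1$, $v_2\to v_0$, $v_0\to v_3$, $v_4\to v_0$, and a single arrow $v_0\to v_5$ (so $v_5$ is a leaf). Then an integer vector $\boldsymbol b=(b_0,\dots,b_5)$ is admissible for $Q$ if and only if $b_5=-2b_0>0$ and $b_1=b_2=b_3=b_4=0$.
   Context: Quivers have no loops/2-cycles; $b_{ij}$ is the number of arrows $v_i\to v_j$ (negative if reversed); mutation $\mu_k$: $b'_{ij}=-b_{ij}$ if $k\in\{i,j\}$, else $b'_{ij}=b_{ij}+\mathrm{sgn}(b_{ik})[b_{ik}b_{kj}]_+$. For a quiver $Q$ on mutable vertices and an integer vector $\boldsymbol b$ indexed by them, add a frozen vertex $q$ with $b_i$ arrows from $v_i$ to $q$ (negative meaning arrows from $q$); mutations only at mutable vertices. $\boldsymbol b$ is admissible if $\boldsymbol b\neq0$ and the resulting quiver with frozen vertex has finite mutation class. *)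

theory Defs
  imports Main
begin

text \<open>
  A quiver without loops and 2-cycles on the vertex type \<open>'v\<close> is its skew-symmetric
  exchange matrix: \<open>B i j\<close> is the number of arrows from \<open>i\<close> to \<open>j\<close>, counted negatively
  if they go from \<open>j\<close> to \<open>i\<close>.
\<close>

type_synonym 'v quiver = "'v \<Rightarrow> 'v \<Rightarrow> int"

definition is_quiver :: "'v quiver \<Rightarrow> bool" where
  "is_quiver B \<longleftrightarrow> (\<forall>i j. B i j = - B j i)"

definition mutate :: "'v \<Rightarrow> 'v quiver \<Rightarrow> 'v quiver" where
  "mutate k B = (\<lambda>i j. if k = i \<or> k = j then - B i j
                       else B i j + sgn (B i k) * max 0 (B i k * B k j))"

text \<open>
  The mutation class consists of labelled quivers. On a finite vertex set it is finite
  iff it is finite up to isomorphism, since an isomorphism class contains only finitely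
  many labelled quivers.
\<close>

inductive_set mutation_class :: "'v set \<Rightarrow> 'v quiver \<Rightarrow> 'v quiver set"
  for M :: "'v set" and B :: "'v quiver"
  where
    base: "B \<in> mutation_class M B"
  | step: "C \<in> mutation_class M B \<Longrightarrow> k \<in> M \<Longrightarrow> mutate k C \<in> mutation_class M B"

text \<open>The frozen vertex is \<open>None\<close>; the mutable vertices are the \<open>Some v\<close>.\<close>

fun add_frozen :: "'v quiver \<Rightarrow> ('v \<Rightarrow> int) \<Rightarrow> 'v option quiver" where
  "add_frozen B b (Some i) (Some j) = B i j"
| "add_frozen B b (Some i) None = b i"
| "add_frozen B b None (Some j) = - b j"
| "add_frozen B b None None = 0"

definition admissible :: "('v::finite) quiver \<Rightarrow> ('v \<Rightarrow> int) \<Rightarrow> bool" where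
  "admissible B b \<longleftrightarrow>
     b \<noteq> (\<lambda>_. 0) \<and> finite (mutation_class (range Some) (add_frozen B b))"

datatype X6_vertex = V0 | V1 | V2 | V3 | V4 | V5

lemma UNIV_X6_vertex: "UNIV = {V0, V1, V2, V3, V4, V5}"
proof -
  have "v \<in> {V0, V1, V2, V3, V4, V5}" for v
    by (cases v) simp_all
  then show ?thesis by blast
qed

instance X6_vertex :: finite
  by standard (simp add: UNIV_X6_vertex)

fun X6_arrows :: "X6_vertex \<Rightarrow> X6_vertex \<Rightarrow> nat" where
  "X6_arrows V1 V2 = 2"
| "X6_arrows V3 V4 = 2"
| "X6_arrows V0 V1 = 1"
| "X6_arrows V2 V0 = 1"
| "X6_arrows V0 V3 = 1"
| "X6_arrows V4 V0 = 1"
| "X6_arrows V0 V5 = 1"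
| "X6_arrows _ _ = 0"

definition X6 :: "X6_vertex quiver" where
  "X6 i j = int (X6_arrows i j) - int (X6_arrows j i)"

lemma is_quiver_X6: "is_quiver X6"
  by (simp add: is_quiver_def X6_def)

lemma is_quiver_add_frozen:
  assumes "is_quiver B"
  shows "is_quiver (add_frozen B b)"
  unfolding is_quiver_def
proof (intro allI)
  fix i j
  show "add_frozen B b i j = - add_frozen B b j i"
  proof (cases i; cases j)
    fix u v assume "i = Some u" "j = Some v"
    moreover have "B u v = - B v u"
      using assms unfolding is_quiver_def by blast
    ultimately show ?thesis by simp
  qed simp_all
qed

lemma is_quiver_mutate:
  assumes "is_quiver B"
  shows "is_quiver (mutate k B)"
  unfolding is_quiver_def
proof (intro allI)
  fix i j
  have skew: "B i j = - B j i" "B i k = - B k i" "B k j = - B j k"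
    using assms unfolding is_quiver_def by blast+
  have "sgn x * max 0 (x * y) = sgn y * max 0 (x * y)" for x y :: int
  proof (cases "x * y > 0")
    case True
    then show ?thesis by (auto simp: zero_less_mult_iff)
  qed simp
  from this[of "B k i" "B j k"]
  have "sgn (B i k) * max 0 (B i k * B k j) = - (sgn (B j k) * max 0 (B j k * B k i))"
    unfolding skew(2,3) by (simp add: mult.commute)
  with skew(1) show "mutate k B i j = - mutate k B j i"
    unfolding mutate_def by presburger
qed

end

theory Submission
  imports Defs "HOL-Combinatorics.Cycles"
begin

text \<open>
  A double arrow \<open>i \<Rightarrow> j\<close> forces \<open>b i = - b j \<le> 0\<close>: otherwise mutating alternately at its two ends
  makes the arrows to the frozen vertex grow without bound. Applying this to \<open>X6\<close> and to the quivers
  reached by mutating at \<open>V0, V1, V2\<close> and at \<open>V0, V3, V4\<close> leaves only the claimed vectors. Conversely,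
  up to a positive factor at the frozen vertex, the claimed vectors extend \<open>X6\<close> to the quiver \<open>X7\<close>,
  whose mutation class consists of two quivers up to isomorphism.
\<close>

section \<open>Finite mutation classes\<close>

lemma mutate_apply:
  "mutate k B i j = (if k = i \<or> k = j then - B i j else B i j + sgn (B i k) * max 0 (B i k * B k j))"
  by (simp add: mutate_def)

lemma is_quiver_mutation_class:
  assumes "is_quiver B" "C \<in> mutation_class M B"
  shows "is_quiver C"
  using assms(2) by induction (auto simp: assms(1) is_quiver_mutate)

lemma is_quiver_skew:
  assumes "is_quiver B"
  shows "B i j = - B j i"
  using assms unfolding is_quiver_def by blast

definition mutation_finite :: "'v set \<Rightarrow> 'v quiver \<Rightarrow> bool" where
  "mutation_finite M B \<longleftrightarrow> finite (mutation_class M B)"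

lemma mutation_finite_mutate:
  assumes "mutation_finite M B" "k \<in> M"
  shows "mutation_finite M (mutate k B)"
proof -
  have "C \<in> mutation_class M B" if "C \<in> mutation_class M (mutate k B)" for C
    using that by induction (auto intro: mutation_class.intros assms(2))
  then show ?thesis
    using assms(1) unfolding mutation_finite_def by (blast intro: finite_subset)
qed

lemma mutation_finite_equivariant:
  assumes "mutation_finite M B"
    and equivariant: "\<And>C k. k \<in> M \<Longrightarrow> mutate k (F C) = F (mutate k C)"
  shows "mutation_finite M (F B)"
  unfolding mutation_finite_def
proof (rule finite_surj)
  show "finite (mutation_class M B)"
    using assms(1) unfolding mutation_finite_def .
  show "mutation_class M (F B) \<subseteq> F ` mutation_class M B"
  proof
    fix C assume "C \<in> mutation_class M (F B)"
    then show "C \<in> F ` mutation_class M B"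
      by induction (auto simp: equivariant intro: mutation_class.intros)
  qed
qed

lemma is_quiver_uminus:
  assumes "is_quiver B"
  shows "is_quiver (- B)"
  using is_quiver_skew[OF assms] unfolding is_quiver_def uminus_apply by metis

lemma mutate_uminus: "mutate k (- B) = - mutate k B"
  by (simp add: fun_eq_iff mutate_apply)

lemma mutation_finite_uminus:
  assumes "mutation_finite M B"
  shows "mutation_finite M (- B)"
  using mutation_finite_equivariant[where F = uminus] assms mutate_uminus .

definition rescale :: "('v \<Rightarrow> int) \<Rightarrow> 'v quiver \<Rightarrow> 'v quiver" where
  "rescale w B = (\<lambda>i j. w i * w j * B i j)"

lemma mutate_rescale:
  assumes "\<And>v. 0 < w v" "w k = 1"
  shows "mutate k (rescale w B) = rescale w (mutate k B)"
proof (intro ext)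
  fix i j
  have "sgn (w i * B i k) = sgn (B i k)"
    using assms(1)[of i] by (simp add: sgn_mult)
  moreover have "max 0 (w i * B i k * (w j * B k j)) = w i * w j * max 0 (B i k * B k j)"
    using assms(1)[of i] assms(1)[of j] by (simp add: max_mult_distrib_left mult_ac)
  ultimately show "mutate k (rescale w B) i j = rescale w (mutate k B) i j"
    using assms(2) by (simp add: mutate_apply rescale_def algebra_simps)
qed

lemma mutation_finite_add_frozen_scale:
  assumes "mutation_finite (range Some) (add_frozen B b)" "0 < c"
  shows "mutation_finite (range Some) (add_frozen B (\<lambda>i. c * b i))"
proof -
  let ?w = "case_option c (\<lambda>_. 1)"
  have "add_frozen B (\<lambda>i. c * b i) x y = rescale ?w (add_frozen B b) x y" for x y
    by (cases x; cases y) (simp_all add: rescale_def)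
  then have "add_frozen B (\<lambda>i. c * b i) = rescale ?w (add_frozen B b)"
    by (intro ext)
  moreover have "mutation_finite (range Some) (rescale ?w (add_frozen B b))"
  proof (rule mutation_finite_equivariant[where F = "rescale ?w"])
    show "mutate k (rescale ?w C) = rescale ?w (mutate k C)" if "k \<in> range Some" for C k
      using assms(2) that by (intro mutate_rescale) (auto split: option.split)
  qed (rule assms(1))
  ultimately show ?thesis by simp
qed

section \<open>Multiple arrows\<close>

lemma mutate_arrow_source:
  assumes "is_quiver B" "0 < B i j" "q \<noteq> i"
  shows "mutate i B j q = B j q + min 0 (B i j * B i q)"
proof -
  have "B j i = - B i j" "i \<noteq> j"
    using is_quiver_skew[OF assms(1), of j i] assms(2) by auto
  then show ?thesis
    using assms(2,3) by (simp add: mutate_apply min_def max_def)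
qed

lemma multiple_arrow_sum_nonneg_if_source_neg:
  assumes "is_quiver B" "mutation_finite M B" "i \<in> M" "j \<in> M" "q \<notin> {i, j}"
    and "2 \<le> B i j" "B i q < 0"
  shows "0 \<le> B i q + B j q"
proof (rule ccontr)
  assume sum_neg: "\<not> 0 \<le> B i q + B j q"
  define escaping where "escaping = {(C, k, l). C \<in> mutation_class M B \<and>
    (k, l) \<in> {(i, j), (j, i)} \<and> 2 \<le> C k l \<and> C k q < 0 \<and> C k q + C l q < 0}"
  have "escaping \<subseteq> mutation_class M B \<times> {i, j} \<times> {i, j}"
    by (auto simp: escaping_def)
  then have "finite escaping"
    using assms(2) unfolding mutation_finite_def by (blast intro: finite_subset)
  moreover have "(B, i, j) \<in> escaping"
    using assms sum_neg by (simp add: escaping_def mutation_class.base)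
  ultimately obtain C k l
    where minimal: "is_arg_min (\<lambda>(C, k, l). C k q) (\<lambda>x. x \<in> escaping) (C, k, l)"
    using ex_is_arg_min_if_finite[of escaping] by (metis empty_iff prod_cases3)
  then have C_in_class: "C \<in> mutation_class M B" and kl: "(k, l) \<in> {(i, j), (j, i)}"
    and C_escapes: "2 \<le> C k l" "C k q < 0" "C k q + C l q < 0"
    by (auto simp: is_arg_min_def escaping_def)
  have quiver: "is_quiver C"
    using is_quiver_mutation_class assms(1) C_in_class .
  let ?C = "mutate k C"
  have reversed: "?C l k = C k l" "?C k q = - C k q"
    using is_quiver_skew[OF quiver, of l k] by (simp_all add: mutate_apply)
  have "C k l * C k q \<le> 2 * C k q"
    using C_escapes by (intro mult_right_mono_neg) simp_all
  then have "?C l q \<le> C l q + 2 * C k q"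
    using mutate_arrow_source[OF quiver, of k l q] C_escapes(1) kl assms(5) by auto
  then have "(?C, l, k) \<in> escaping" and "?C l q < C k q"
    using C_in_class kl C_escapes reversed assms(3,4)
    by (auto simp: escaping_def intro: mutation_class.step)
  then show False
    using minimal by (auto simp: is_arg_min_def)
qed

lemma multiple_arrow_nonneg:
  assumes "is_quiver B" "mutation_finite M B" "i \<in> M" "j \<in> M" "q \<notin> {i, j}" "2 \<le> B i j"
  shows "0 \<le> B j q" and "0 \<le> B i q + B j q"
proof -
  note sum_nonneg = multiple_arrow_sum_nonneg_if_source_neg
  have "0 \<le> B j q" if "0 \<le> B i q"
  proof (rule ccontr)
    assume neg: "\<not> 0 \<le> B j q"
    have "mutate i B j i = B i j" "mutate i B i q = - B i q"
      using is_quiver_skew[OF assms(1), of j i] by (simp_all add: mutate_apply)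
    moreover have "mutate i B j q = B j q"
      using mutate_arrow_source[OF assms(1), of i j q] assms(5,6) that by simp
    ultimately have "B i q \<le> B j q"
      using sum_nonneg[OF is_quiver_mutate[OF assms(1)]
          mutation_finite_mutate[OF assms(2,3)] assms(4,3), of q] assms(5,6) neg by simp
    then show False using that neg by linarith
  qed
  moreover have "0 \<le> B i q + B j q" if "B i q < 0"
    using sum_nonneg[OF assms that] .
  ultimately show "0 \<le> B j q" and "0 \<le> B i q + B j q"
    by linarith+
qed

text \<open>In \<open>- B\<close> all arrows are reversed, which turns the lower bounds into upper bounds.\<close>

lemma multiple_arrow_balanced:
  assumes "is_quiver B" "mutation_finite M B" "i \<in> M" "j \<in> M" "q \<notin> {i, j}" "2 \<le> B i j"
  shows "B j q = - B i q" and "B i q \<le> 0"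
proof -
  have "(- B) j i = B i j"
    using is_quiver_skew[OF assms(1), of j i] by simp
  then have "0 \<le> (- B) i q" "0 \<le> (- B) j q + (- B) i q"
    using multiple_arrow_nonneg[OF is_quiver_uminus[OF assms(1)]
        mutation_finite_uminus[OF assms(2)] assms(4,3), of q] assms(5,6) by simp_all
  moreover have "0 \<le> B i q + B j q"
    using multiple_arrow_nonneg(2)[OF assms] .
  ultimately show "B j q = - B i q" and "B i q \<le> 0"
    by simp_all
qed

section \<open>Mutation classes up to isomorphism\<close>

definition relabel :: "('v \<Rightarrow> 'v) \<Rightarrow> 'v quiver \<Rightarrow> 'v quiver" where
  "relabel f B = (\<lambda>i j. B (f i) (f j))"

lemma relabel_apply: "relabel f B i j = B (f i) (f j)"
  by (simp add: relabel_def)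

lemma mutate_relabel:
  assumes "bij f"
  shows "mutate k (relabel f B) = relabel f (mutate (f k) B)"
  using bij_is_inj[OF assms] by (simp add: mutate_def relabel_def inj_eq)

definition isomorphic :: "'v quiver \<Rightarrow> 'v quiver \<Rightarrow> bool" where
  "isomorphic C D \<longleftrightarrow> (\<exists>f. bij f \<and> C = relabel f D)"

lemma isomorphic_relabel:
  assumes "bij f"
  shows "isomorphic (relabel f D) D"
  using assms unfolding isomorphic_def by blast

lemma isomorphic_refl: "isomorphic C C"
  using isomorphic_relabel[of id C] by (simp add: relabel_def)

lemma isomorphic_trans:
  assumes "isomorphic C D" "isomorphic D E"
  shows "isomorphic C E"
proof -
  obtain f g where "bij f" "C = relabel f D" "bij g" "D = relabel g E"
    using assms unfolding isomorphic_def by blast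
  then have "bij (g \<circ> f)" "C = relabel (g \<circ> f) E"
    by (simp_all add: bij_comp relabel_def)
  then show ?thesis unfolding isomorphic_def by blast
qed

lemma finite_isomorphic: "finite {C. isomorphic C (D :: 'v::finite quiver)}"
proof (rule finite_subset)
  show "{C. isomorphic C D} \<subseteq> range (\<lambda>f. relabel f D)"
    unfolding isomorphic_def by blast
qed simp

lemma mutation_finite_if_closed_up_to_isomorphism:
  fixes B :: "'v::finite quiver"
  assumes "finite S" "B \<in> S"
    and closed: "\<And>C k. C \<in> S \<Longrightarrow> \<exists>D\<in>S. isomorphic (mutate k C) D"
  shows "mutation_finite M B"
  unfolding mutation_finite_def
proof (rule finite_subset)
  show "finite (\<Union>D\<in>S. {C. isomorphic C D})"
    using assms(1) finite_isomorphic by blast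
  show "mutation_class M B \<subseteq> (\<Union>D\<in>S. {C. isomorphic C D})"
  proof
    fix C assume "C \<in> mutation_class M B"
    then show "C \<in> (\<Union>D\<in>S. {C. isomorphic C D})"
    proof induction
      case base
      then show ?case using assms(2) isomorphic_refl by blast
    next
      case (step C k)
      then obtain f D where "D \<in> S" "bij f" "C = relabel f D"
        unfolding isomorphic_def by blast
      then have "isomorphic (mutate k C) (mutate (f k) D)"
        by (simp add: mutate_relabel isomorphic_relabel)
      moreover obtain E where "E \<in> S" "isomorphic (mutate (f k) D) E"
        using closed[OF \<open>D \<in> S\<close>] by blast
      ultimately show ?case using isomorphic_trans by blast
    qed
  qed
qed

lemma isomorphic_mutate_automorphism:
  assumes "bij f" "relabel f C = C"
  shows "isomorphic (mutate k C) (mutate (f k) C)"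
  using isomorphic_relabel[OF assms(1), of "mutate (f k) C"]
  by (simp add: assms(2) flip: mutate_relabel[OF assms(1)])

section \<open>The mutation class of X7\<close>

lemma all_X6_vertex: "(\<forall>v. P v) \<longleftrightarrow> P V0 \<and> P V1 \<and> P V2 \<and> P V3 \<and> P V4 \<and> P V5"
  using X6_vertex.exhaust[of v "P v" for v] by auto

lemma all_X6_vertex_option:
  "(\<forall>v. P v) \<longleftrightarrow> P None \<and> P (Some V0) \<and> P (Some V1) \<and> P (Some V2) \<and> P (Some V3) \<and>
    P (Some V4) \<and> P (Some V5)"
  unfolding split_option_all all_X6_vertex ..

definition X7_row :: "X6_vertex \<Rightarrow> int" where
  "X7_row = (\<lambda>_. 0)(V0 := - 1, V5 := 2)"

definition X7 :: "X6_vertex option quiver" where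
  "X7 = add_frozen X6 X7_row"

lemmas X7_entries = X7_def X7_row_def X6_def

lemma bij_cycle_of_list: "bij (cycle_of_list cs)"
  using cycle_permutes by (rule permutes_bij)

text \<open>
  The three double arrows \<open>V1 \<Rightarrow> V2\<close>, \<open>V3 \<Rightarrow> V4\<close>, \<open>V5 \<Rightarrow> None\<close> of \<open>X7\<close> form oriented triangles with
  \<open>V0\<close>, and the rotation permutes these cyclically, so only mutations at \<open>V0, V1, V2\<close> need computing.
\<close>

definition X7_rotation :: "X6_vertex option \<Rightarrow> X6_vertex option" where
  "X7_rotation =
    cycle_of_list [Some V1, Some V3, Some V5] \<circ> cycle_of_list [Some V2, Some V4, None]"

lemma bij_X7_rotation: "bij X7_rotation"
  unfolding X7_rotation_def by (intro bij_comp bij_cycle_of_list)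

lemma X7_rotation_simps [simp]:
  "X7_rotation (Some V0) = Some V0"
  "X7_rotation (Some V1) = Some V3" "X7_rotation (Some V3) = Some V5" "X7_rotation (Some V5) = Some V1"
  "X7_rotation (Some V2) = Some V4" "X7_rotation (Some V4) = None" "X7_rotation None = Some V2"
  by (simp_all add: X7_rotation_def transpose_def)

lemma relabel_X7_rotation: "relabel X7_rotation X7 = X7"
  unfolding fun_eq_iff all_X6_vertex_option by (simp add: relabel_apply X7_entries)

definition X7_mutated :: "X6_vertex option quiver" where
  "X7_mutated = mutate (Some V0) X7"

lemma relabel_X7_rotation_mutated: "relabel X7_rotation X7_mutated = X7_mutated"
  using mutate_relabel[OF bij_X7_rotation, of "Some V0" X7]
  by (simp add: X7_mutated_def relabel_X7_rotation)

lemma mutate_V0_X7_mutated: "mutate (Some V0) X7_mutated = X7"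
  unfolding fun_eq_iff all_X6_vertex_option
  by (simp add: mutate_apply X7_mutated_def X7_entries)

lemma isomorphic_mutate_X7:
  "isomorphic (mutate (Some V1) X7) X7" "isomorphic (mutate (Some V2) X7) X7"
proof -
  let ?f = "transpose (Some V1) (Some V2)"
  have "mutate (Some V1) X7 = relabel ?f X7" "mutate (Some V2) X7 = relabel ?f X7"
    unfolding fun_eq_iff all_X6_vertex_option
    by (simp_all add: relabel_apply mutate_apply X7_entries transpose_def)
  then show "isomorphic (mutate (Some V1) X7) X7" "isomorphic (mutate (Some V2) X7) X7"
    by (simp_all add: isomorphic_relabel)
qed

lemma isomorphic_mutate_X7_mutated:
  "isomorphic (mutate (Some V1) X7_mutated) X7_mutated"
  "isomorphic (mutate (Some V2) X7_mutated) X7_mutated"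
proof -
  let ?g = "cycle_of_list [Some V3, Some V4, Some V5, None]"
  have "mutate (Some V1) X7_mutated =
      relabel (cycle_of_list [Some V0, Some V1, Some V2] \<circ> ?g) X7_mutated"
    and "mutate (Some V2) X7_mutated =
      relabel (cycle_of_list [Some V0, Some V2, Some V1] \<circ> ?g) X7_mutated"
    unfolding fun_eq_iff all_X6_vertex_option
    by (simp_all add: relabel_apply mutate_apply X7_mutated_def X7_entries transpose_def)
  then show "isomorphic (mutate (Some V1) X7_mutated) X7_mutated"
    and "isomorphic (mutate (Some V2) X7_mutated) X7_mutated"
    by (simp_all only: isomorphic_relabel bij_comp bij_cycle_of_list)
qed

lemma isomorphic_mutate_if_X7_rotation_invariant:
  assumes "relabel X7_rotation C = C"
    and "\<And>v. v \<in> {V0, V1, V2} \<Longrightarrow> \<exists>D\<in>S. isomorphic (mutate (Some v) C) D"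
  shows "\<exists>D\<in>S. isomorphic (mutate k C) D"
proof -
  define reduces where "reduces k \<longleftrightarrow> (\<exists>D\<in>S. isomorphic (mutate k C) D)" for k
  have unrotate: "reduces k" if "reduces (X7_rotation k)" for k
    using that isomorphic_mutate_automorphism[OF bij_X7_rotation assms(1)] isomorphic_trans
    unfolding reduces_def by blast
  have "reduces (Some V0)" "reduces (Some V1)" "reduces (Some V2)"
    using assms(2) unfolding reduces_def by simp_all
  moreover from this have "reduces (Some V5)" "reduces None"
    using unrotate by simp_all
  moreover from this have "reduces (Some V3)" "reduces (Some V4)"
    using unrotate by simp_all
  ultimately have "\<forall>k. reduces k"
    unfolding all_X6_vertex_option by blast
  then show ?thesis unfolding reduces_def by blast
qed

lemma mutation_finite_X7: "mutation_finite M X7"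
proof (rule mutation_finite_if_closed_up_to_isomorphism)
  let ?S = "{X7, X7_mutated}"
  have "\<exists>D\<in>?S. isomorphic (mutate k X7) D" for k
  proof (rule isomorphic_mutate_if_X7_rotation_invariant[OF relabel_X7_rotation])
    fix v assume "v \<in> {V0, V1, V2}"
    then show "\<exists>D\<in>?S. isomorphic (mutate (Some v) X7) D"
      using isomorphic_mutate_X7 isomorphic_refl[of X7_mutated]
      unfolding X7_mutated_def by blast
  qed
  moreover have "\<exists>D\<in>?S. isomorphic (mutate k X7_mutated) D" for k
  proof (rule isomorphic_mutate_if_X7_rotation_invariant[OF relabel_X7_rotation_mutated])
    fix v assume "v \<in> {V0, V1, V2}"
    then show "\<exists>D\<in>?S. isomorphic (mutate (Some v) X7_mutated) D"
      using isomorphic_mutate_X7_mutated isomorphic_refl[of X7] mutate_V0_X7_mutated by auto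
  qed
  ultimately show "\<exists>D\<in>?S. isomorphic (mutate k C) D" if "C \<in> ?S" for C k
    using that by blast
qed simp_all

section \<open>Admissible vectors for X6\<close>

lemma admissible_iff_mutation_finite:
  "admissible B b \<longleftrightarrow> b \<noteq> (\<lambda>_. 0) \<and> mutation_finite (range Some) (add_frozen B b)"
  by (simp add: admissible_def mutation_finite_def)

lemma multiple_arrow_frozen_balanced:
  assumes "is_quiver B" "mutation_finite (range Some) B" "2 \<le> B (Some i) (Some j)"
  shows "B (Some j) None = - B (Some i) None" and "B (Some i) None \<le> 0"
  using multiple_arrow_balanced[OF assms(1,2) _ _ _ assms(3)] by simp_all

lemma X6_frozen_balanced:
  assumes "mutation_finite (range Some) (add_frozen X6 b)"
  shows "b V2 = - b V1" "b V1 \<le> 0" "b V4 = - b V3" "b V3 \<le> 0"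
proof -
  note balanced =
    multiple_arrow_frozen_balanced[OF is_quiver_add_frozen[OF is_quiver_X6] assms]
  show "b V2 = - b V1" "b V1 \<le> 0"
    using balanced[of V1 V2] by (simp_all add: X6_def)
  show "b V4 = - b V3" "b V3 \<le> 0"
    using balanced[of V3 V4] by (simp_all add: X6_def)
qed

lemma X6_frozen_balanced_mutate_V0_V1_V2:
  assumes "mutation_finite (range Some) (add_frozen X6 b)"
  shows "b V5 - 2 * max 0 (- b V0) = - (b V4 + 2 * max 0 (b V0))"
    and "b V4 + 2 * max 0 (b V0) \<le> 0"
proof -
  let ?C = "mutate (Some V2) (mutate (Some V1) (mutate (Some V0) (add_frozen X6 b)))"
  have "is_quiver ?C" "mutation_finite (range Some) ?C"
    using assms
    by (simp_all add: is_quiver_mutate is_quiver_add_frozen is_quiver_X6 mutation_finite_mutate)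
  moreover have "2 \<le> ?C (Some V4) (Some V5)"
    by (simp add: mutate_apply X6_def)
  ultimately have "?C (Some V5) None = - ?C (Some V4) None" "?C (Some V4) None \<le> 0"
    by (rule multiple_arrow_frozen_balanced)+
  moreover have "?C (Some V4) None = b V4 + 2 * max 0 (b V0)"
    and "?C (Some V5) None = b V5 - 2 * max 0 (- b V0)"
    using X6_frozen_balanced(1,2)[OF assms] by (auto simp: mutate_apply X6_def max_def)
  ultimately show "b V5 - 2 * max 0 (- b V0) = - (b V4 + 2 * max 0 (b V0))"
    and "b V4 + 2 * max 0 (b V0) \<le> 0"
    by simp_all
qed

lemma X6_frozen_balanced_mutate_V0_V3_V4:
  assumes "mutation_finite (range Some) (add_frozen X6 b)"
  shows "b V2 + 2 * max 0 (b V0) \<le> 0"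
proof -
  let ?C = "mutate (Some V4) (mutate (Some V3) (mutate (Some V0) (add_frozen X6 b)))"
  have "is_quiver ?C" "mutation_finite (range Some) ?C"
    using assms
    by (simp_all add: is_quiver_mutate is_quiver_add_frozen is_quiver_X6 mutation_finite_mutate)
  moreover have "2 \<le> ?C (Some V2) (Some V5)"
    by (simp add: mutate_apply X6_def)
  ultimately have "?C (Some V2) None \<le> 0"
    by (rule multiple_arrow_frozen_balanced)
  moreover have "?C (Some V2) None = b V2 + 2 * max 0 (b V0)"
    using X6_frozen_balanced(3,4)[OF assms] by (auto simp: mutate_apply X6_def max_def)
  ultimately show ?thesis by simp
qed

theorem theorem6p2:
  fixes b :: "X6_vertex \<Rightarrow> int"
  shows "admissible X6 b \<longleftrightarrow>
    b V5 = - 2 * b V0 \<and> - 2 * b V0 > 0 \<and> b V1 = 0 \<and> b V2 = 0 \<and> b V3 = 0 \<and> b V4 = 0"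
proof
  assume "admissible X6 b"
  then have "b \<noteq> (\<lambda>_. 0)" and finite: "mutation_finite (range Some) (add_frozen X6 b)"
    by (simp_all add: admissible_iff_mutation_finite)
  have b1234: "b V1 = 0" "b V2 = 0" "b V3 = 0" "b V4 = 0" and "b V0 \<le> 0"
    using X6_frozen_balanced[OF finite] X6_frozen_balanced_mutate_V0_V1_V2(2)[OF finite]
      X6_frozen_balanced_mutate_V0_V3_V4[OF finite] by linarith+
  moreover from this have b5: "b V5 = - 2 * b V0"
    using X6_frozen_balanced_mutate_V0_V1_V2(1)[OF finite] by linarith
  moreover have "b V0 \<noteq> 0"
    using \<open>b \<noteq> (\<lambda>_. 0)\<close> b1234 b5 unfolding fun_eq_iff all_X6_vertex by auto
  ultimately show "b V5 = - 2 * b V0 \<and> - 2 * b V0 > 0 \<and> b V1 = 0 \<and> b V2 = 0 \<and> b V3 = 0 \<and> b V4 = 0"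
    by linarith
next
  assume b: "b V5 = - 2 * b V0 \<and> - 2 * b V0 > 0 \<and> b V1 = 0 \<and> b V2 = 0 \<and> b V3 = 0 \<and> b V4 = 0"
  then have "b = (\<lambda>i. - b V0 * X7_row i)"
    unfolding fun_eq_iff all_X6_vertex by (simp add: X7_row_def)
  moreover have "mutation_finite (range Some) (add_frozen X6 (\<lambda>i. - b V0 * X7_row i))"
    using b mutation_finite_X7 unfolding X7_def by (intro mutation_finite_add_frozen_scale) simp_all
  moreover have "b \<noteq> (\<lambda>_. 0)" using b by auto
  ultimately show "admissible X6 b"
    by (simp add: admissible_iff_mutation_finite)
qed

end
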